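(* The following properties are true. (a) $\mathcal{H}_0\subset\mathcal{H}$. (b) $\int A_c(\tau_a(x))\,d\mu(x,c,a)\le\bar u$ for all $\mu\in\mathcal{H}_0$. (c) If $\bar c$ and $\bar a$ are optimal in $x_0$ and $\mu^{n}_{\bar c,\bar a,x_0}\rightharpoonup\mu_\infty$ (up to a subsequence $n_k\to\infty$), then $\int A_c(\tau_a(x))\,d\mu_\infty(x,c,a)=\bar u$. (d) $\displaystyle\sup_{\mu\in\mathcal{H}_0}\int A_c(\tau_a(x))\,d\mu(x,c,a)=\bar u$. (e) $\bar u=m(R)$.
   Context: $X=\mathbb{R}/\mathbb{Z}$ is the circle, $\mathcal{C}=\{0,\dots,m-1\}$ with $m\ge2$, $\mathcal{I}=\{0,1\}$, $A_c:X\to\mathbb{R}$, $c\in\mathcal{C}$, are Lipschitz functions, and $R=(X,\tau_a)_{a\in\mathcal{I}}$ is the IFS given by the inverse branches $\tau_i(x)=\frac12x+\frac i2$ (with $x\in[0,1)$ as representative) of the doubling map $T(x)=2x$. For continuous $g:X\to\mathbb{R}$ put $d_xg(a)=g(\tau_a(x))-g(x)$. The set of holonomic probabilities is $$\mathcal{H}=\left\{\mu\in\mathrm{Prob}(X\times\mathcal{C}\times\mathcal{I}) : \int d_xg(a)\,d\mu(x,c,a)=0\ \ \forall g\in C^0(X,\mathbb{R})\right\},$$ and $m(R)=\sup_{\mu\in\mathcal{H}}\int A_c(\tau_a(x))\,d\mu(x,c,a)$. For $0<\lambda<1$, $v_\lambda$ denotes the unique Lipschitz continuous solution of the Bellman equation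 $v_\lambda(x)=\sup_{(c,a)\in\mathcal{C}\times\mathcal{I}}[A_c(\tau_a(x))+\lambda v_\lambda(\tau_a(x))]$. The constant $\bar u$ is $\bar u=\lim_{\lambda\to1}(1-\lambda)\max_{x\in X}v_\lambda(x)$, and $b:X\to\mathbb{R}$ is a continuous function, obtained as a limit of $v_\lambda-\max v_\lambda$ along a subsequence $\lambda\to1$, satisfying the sub-action equation $\bar u=\max_{(c,a)\in\mathcal{C}\times\mathcal{I}}[A_c(\tau_a(x))+b(\tau_a(x))-b(x)]$ for all $x\in X$. For $x_0\in X$, $\bar c=(c_0,c_1,\dots)\in\mathcal{C}^{\mathbb{N}}$, $\bar a=(a_0,a_1,\dots)\in\mathcal{I}^{\mathbb{N}}$, let $x_{i+1}=\tau_{a_i}(x_i)$, and let $\mu^n_{\bar c,\bar a,x_0}$ be the probability on $X\times\mathcal{C}\times\mathcal{I}$ given by $\int g\,d\mu^n_{\bar c,\bar a,x_0}=\frac1n\sum_{i=0}^{n-1}g(x_i,c_i,a_i)$. $\mathcal{H}_0$ (the empirical holonomic measures) is the set of all cluster points, in the weak-* topology (convergence denoted $\rightharpoonup$), of the sequences $(\mu^n_{\bar c,\bar a,x_0})_{n\in\mathbb{N}}$, over all $x_0,\bar c,\bar a$. The pair $\bar c,\bar a$ is optimal in $x_0$ if equality holds in the sub-action equation along the orbit, i.e. $\bar u=A_{c_i}(\tau_{a_i}(x_i))+b(\tau_{a_i}(x_i))-b(x_i)$ for all $i\ge0$.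
   Formalization: Weak-* convergence uses the topology on X×C×I making (x,c,a)↦(τ_a(x),c) a homeomorphism onto X×C, not the product topology: there (a) fails, since x_0=0, a_i=1, c_i=0 gives the limit δ_(0,0,1), which is not holonomic as τ_1(0)=1/2. *)

theory Defs
  imports "HOL-Probability.Probability"
begin

section \<open>The circle\<close>

definition circle_rel :: "real \<Rightarrow> real \<Rightarrow> bool" where
  "circle_rel x y \<longleftrightarrow> x - y \<in> \<int>"

quotient_type circle = real / circle_rel
proof (rule equivpI)
  show "reflp circle_rel" by (auto simp: reflp_def circle_rel_def)
  show "symp circle_rel"
    unfolding symp_def circle_rel_def by (metis Ints_minus minus_diff_eq)
  show "transp circle_rel"
    unfolding transp_def circle_rel_def by (metis Ints_add diff_add_cancel add_diff_eq)
qed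

lift_definition circle_of :: "real \<Rightarrow> circle" is "\<lambda>x. x" .

text \<open>The representative in \<open>[0,1)\<close>.\<close>

lift_definition rep01 :: "circle \<Rightarrow> real" is frac
  unfolding circle_rel_def by (metis diff_add_cancel frac_add_int_left)

lemma rep01_bounds: "0 \<le> rep01 x" "rep01 x < 1"
  by (transfer; simp add: frac_lt_1)+

lemma circle_of_rep01: "circle_of (rep01 x) = x"
  by transfer (auto simp: circle_rel_def frac_def)

lemma rep01_circle_of: "rep01 (circle_of t) = frac t"
  by transfer simp

text \<open>The quotient metric: the distance from \<open>x - y\<close> to the nearest integer.\<close>

lemma dist_int_le:
  fixes x :: real assumes "k \<in> \<int>" shows "\<bar>x - of_int (round x)\<bar> \<le> \<bar>x - k\<bar>"
  using assms round_diff_minimal[of x] by (auto elim!: Ints_cases)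

instantiation circle :: metric_space
begin

lift_definition dist_circle :: "circle \<Rightarrow> circle \<Rightarrow> real"
  is "\<lambda>x y. \<bar>(x - y) - of_int (round (x - y))\<bar>"
proof -
  fix x x' y y' :: real
  assume a: "circle_rel x x'" "circle_rel y y'"
  have le: "\<bar>s - of_int (round s)\<bar> \<le> \<bar>t - of_int (round t)\<bar>" if "s - t \<in> \<int>" for s t :: real
    using dist_int_le[of "(s - t) + of_int (round t)" s] that by simp
  have "(x - y) - (x' - y') \<in> \<int>" "(x' - y') - (x - y) \<in> \<int>"
    using Ints_diff[of "x - x'" "y - y'"] Ints_diff[of "y - y'" "x - x'"] a
    by (simp_all add: circle_rel_def algebra_simps)
  then show "\<bar>(x - y) - of_int (round (x - y))\<bar> = \<bar>(x' - y') - of_int (round (x' - y'))\<bar>"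
    by (meson le order_antisym)
qed

definition uniformity_circle :: "(circle \<times> circle) filter" where
  "uniformity_circle = (INF e\<in>{0 <..}. principal {(x, y). dist x y < e})"

definition open_circle :: "circle set \<Rightarrow> bool" where
  "open_circle U \<longleftrightarrow> (\<forall>x\<in>U. \<forall>\<^sub>F (x', y) in uniformity. x' = x \<longrightarrow> y \<in> U)"

instance
proof
  fix x y z :: circle
  show "(dist x y = 0) = (x = y)"
  proof (transfer, unfold circle_rel_def, rule iffI)
    fix x y :: real
    assume "\<bar>(x - y) - of_int (round (x - y))\<bar> = 0"
    then have "x - y = of_int (round (x - y))" by simp
    then show "x - y \<in> \<int>" by (metis Ints_of_int)
  next
    fix x y :: real
    assume "x - y \<in> \<int>"
    then show "\<bar>(x - y) - of_int (round (x - y))\<bar> = 0"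
      by (auto elim!: Ints_cases)
  qed
  show "dist x y \<le> dist x z + dist y z"
  proof transfer
    fix x y z :: real
    have "\<bar>(x - y) - of_int (round (x - y))\<bar>
      \<le> \<bar>(x - y) - (of_int (round (x - z)) - of_int (round (y - z)))\<bar>"
      by (rule dist_int_le) simp
    then show "\<bar>(x - y) - of_int (round (x - y))\<bar>
      \<le> \<bar>(x - z) - of_int (round (x - z))\<bar> + \<bar>(y - z) - of_int (round (y - z))\<bar>"
      by linarith
  qed
qed (simp_all only: uniformity_circle_def open_circle_def)

end

section \<open>The iterated function system and its orbits\<close>

definition tau :: "nat \<Rightarrow> circle \<Rightarrow> circle" where
  "tau a x = circle_of (rep01 x / 2 + real a / 2)"

lemma dist_rep01: "\<exists>k::int. dist x y = \<bar>rep01 x - rep01 y - of_int k\<bar>"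
proof -
  have "dist (circle_of s) (circle_of t) = \<bar>s - t - of_int (round (s - t))\<bar>" for s t
    by transfer simp
  from this[of "rep01 x" "rep01 y"] show ?thesis by (auto simp: circle_of_rep01)
qed

lemma continuous_on_circle_of: "continuous_on UNIV circle_of"
proof -
  have "dist (circle_of s) (circle_of t) \<le> dist s t" for s t
    using dist_int_le[of 0 "s - t"] by transfer (simp add: dist_real_def)
  then show ?thesis
    unfolding continuous_on_iff by (meson le_less_trans)
qed

lemma continuous_on_rep01: "continuous_on (- {circle_of 0}) rep01"
  unfolding continuous_on_iff
proof (intro ballI allI impI)
  fix x :: circle and e :: real assume x: "x \<in> - {circle_of 0}" and e: "0 < e"
  let ?r = "rep01 x"
  have "?r \<noteq> 0" using x circle_of_rep01[of x] by auto
  then have r: "0 < ?r" "?r < 1" using rep01_bounds[of x] by auto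
  show "\<exists>d>0. \<forall>y\<in>- {circle_of 0}. dist y x < d \<longrightarrow> dist (rep01 y) (rep01 x) < e"
  proof (intro exI[of _ "min e (min ?r (1 - ?r))"] conjI ballI impI)
    show "0 < min e (min ?r (1 - ?r))" using r e by simp
    fix y assume d: "dist y x < min e (min ?r (1 - ?r))"
    obtain k :: int where k: "dist y x = \<bar>rep01 y - ?r - of_int k\<bar>" using dist_rep01 by blast
    have "real_of_int k < 1" "real_of_int k > -1" using k d rep01_bounds[of y] by linarith+
    then have "k = 0" by linarith
    then show "dist (rep01 y) ?r < e" using k d by (simp add: dist_real_def)
  qed
qed

lemma rep01_measurable [measurable]: "rep01 \<in> borel_measurable borel"
  using continuous_on_rep01 borel_measurable_continuous_countable_exceptions[of "{circle_of 0}" rep01]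
  by simp

lemma tau_measurable [measurable]: "tau a \<in> borel_measurable borel"
proof -
  have [measurable]: "circle_of \<in> borel_measurable borel"
    by (rule borel_measurable_continuous_onI[OF continuous_on_circle_of])
  show ?thesis unfolding tau_def by measurable
qed

lemma rep01_tau: "a \<in> {0, 1} \<Longrightarrow> rep01 (tau a x) = rep01 x / 2 + real a / 2"
  unfolding tau_def rep01_circle_of using rep01_bounds[of x] by (intro frac_eq_id) auto

primrec orbit :: "circle \<Rightarrow> (nat \<Rightarrow> nat) \<Rightarrow> nat \<Rightarrow> circle" where
  "orbit x0 abar 0 = x0"
| "orbit x0 abar (Suc i) = tau (abar i) (orbit x0 abar i)"

section \<open>Holonomic probabilities\<close>

definition phase_space :: "nat \<Rightarrow> (circle \<times> nat \<times> nat) measure" where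
  "phase_space m = borel \<Otimes>\<^sub>M (count_space {..<m} \<Otimes>\<^sub>M count_space {0, 1})"

definition Prob :: "'a measure \<Rightarrow> 'a measure set" where
  "Prob M = {\<mu>. prob_space \<mu> \<and> sets \<mu> = sets M}"

definition holonomic :: "nat \<Rightarrow> (circle \<times> nat \<times> nat) measure set" where
  "holonomic m = {\<mu> \<in> Prob (phase_space m).
     \<forall>g :: circle \<Rightarrow> real. continuous_on UNIV g \<longrightarrow>
       (\<integral>(x, c, a). g (tau a x) - g x \<partial>\<mu>) = 0}"

definition m_value :: "nat \<Rightarrow> (nat \<Rightarrow> circle \<Rightarrow> real) \<Rightarrow> real" where
  "m_value m A = (SUP \<mu>\<in>holonomic m. \<integral>(x, c, a). A c (tau a x) \<partial>\<mu>)"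

section \<open>Empirical holonomic measures\<close>

definition empirical ::
  "nat \<Rightarrow> (nat \<Rightarrow> nat) \<Rightarrow> (nat \<Rightarrow> nat) \<Rightarrow> circle \<Rightarrow> nat \<Rightarrow> (circle \<times> nat \<times> nat) measure" where
  "empirical m cbar abar x0 n =
     distr (uniform_count_measure {..<n}) (phase_space m) (\<lambda>i. (orbit x0 abar i, cbar i, abar i))"

lemma space_phase_space: "space (phase_space m) = UNIV \<times> {..<m} \<times> {0, 1}"
  by (simp add: phase_space_def space_pair_measure)

lemma borel_measurable_phase_space:
  fixes f :: "circle \<times> nat \<times> nat \<Rightarrow> real"
  assumes "\<And>c a. c \<in> {..<m} \<Longrightarrow> a \<in> {0, 1} \<Longrightarrow> (\<lambda>x. f (x, c, a)) \<in> borel_measurable borel"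
  shows "f \<in> borel_measurable (phase_space m)"
proof (rule measurableI)
  fix B :: "real set" assume B: "B \<in> sets borel"
  have "f -` B \<inter> space (phase_space m) =
      (\<Union>(c, a)\<in>{..<m} \<times> {0, 1}. ((\<lambda>x. f (x, c, a)) -` B) \<times> ({c} \<times> {a}))"
    by (auto simp: space_phase_space)
  also have "\<dots> \<in> sets (phase_space m)"
  proof (rule sets.finite_UN)
    fix ca :: "nat \<times> nat" assume "ca \<in> {..<m} \<times> {0, 1}"
    then obtain c a where ca: "ca = (c, a)" "c \<in> {..<m}" "a \<in> {0, 1}" by blast
    have "(\<lambda>x. f (x, c, a)) -` B \<in> sets borel"
      using measurable_sets[OF assms[OF ca(2,3)] B] by simp
    then have "((\<lambda>x. f (x, c, a)) -` B) \<times> ({c} \<times> {a}) \<in> sets (phase_space m)"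
      unfolding phase_space_def using ca by (intro pair_measureI) auto
    then show "(case ca of (c, a) \<Rightarrow> ((\<lambda>x. f (x, c, a)) -` B) \<times> ({c} \<times> {a})) \<in> sets (phase_space m)"
      by (simp add: ca(1))
  qed simp
  finally show "f -` B \<inter> space (phase_space m) \<in> sets (phase_space m)" .
qed simp

lemma
  assumes "\<And>i. cbar i \<in> {..<m}" "\<And>i. abar i \<in> {0, 1}" "0 < n"
  shows empirical_in_Prob: "empirical m cbar abar x0 n \<in> Prob (phase_space m)"
    and integral_empirical: "f \<in> borel_measurable (phase_space m) \<Longrightarrow>
      (\<integral>z. f z \<partial>empirical m cbar abar x0 n) =
        (\<Sum>i<n. f (orbit x0 abar i, cbar i, abar i)) / real n"
proof -
  have meas: "(\<lambda>i. (orbit x0 abar i, cbar i, abar i))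
      \<in> measurable (uniform_count_measure {..<n}) (phase_space m)"
    using assms by (auto simp: measurable_def sets_uniform_count_measure space_uniform_count_measure
      space_phase_space)
  have "prob_space (uniform_count_measure {..<n})"
    using assms by (intro prob_space_uniform_count_measure) auto
  then show "empirical m cbar abar x0 n \<in> Prob (phase_space m)"
    unfolding Prob_def empirical_def using meas by (auto intro: prob_space.prob_space_distr)
  show "(\<integral>z. f z \<partial>empirical m cbar abar x0 n) =
        (\<Sum>i<n. f (orbit x0 abar i, cbar i, abar i)) / real n"
    if "f \<in> borel_measurable (phase_space m)" for f :: "_ \<Rightarrow> real"
    unfolding empirical_def using that meas
    by (simp add: integral_distr integral_uniform_count_measure)
qed

text \<open>The weak-* topology on the probabilities on \<open>M\<close>, for a topology \<open>K\<close> on the space of \<open>M\<close>: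
  the initial topology of the functionals \<open>\<mu> \<mapsto> \<integral>f d\<mu>\<close>, \<open>f \<in> C(K)\<close>.\<close>

definition weak_star :: "'a topology \<Rightarrow> 'a measure \<Rightarrow> 'a measure topology" where
  "weak_star K M = (let C = {f. continuous_map K euclideanreal f} in
     pullback_topology (Prob M) (\<lambda>\<mu>. \<lambda>f\<in>C. \<integral>z. f z \<partial>\<mu>) (product_topology (\<lambda>_. euclideanreal) C))"

lemma topspace_weak_star: "topspace (weak_star K M) = Prob M"
  by (auto simp: weak_star_def Let_def topspace_pullback_topology)

lemma limitin_weak_star:
  "limitin (weak_star K M) s \<mu> F \<longleftrightarrow> \<mu> \<in> Prob M \<and> (\<forall>\<^sub>F n in F. s n \<in> Prob M) \<and>
     (\<forall>f. continuous_map K euclideanreal f \<longrightarrow> ((\<lambda>n. \<integral>z. f z \<partial>s n) \<longlongrightarrow> (\<integral>z. f z \<partial>\<mu>)) F)"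
proof -
  define C where "C = {f. continuous_map K euclideanreal f}"
  define \<Phi> where "\<Phi> = (\<lambda>\<mu> :: 'a measure. \<lambda>f\<in>C. \<integral>z. f z \<partial>\<mu>)"
  define P where "P = product_topology (\<lambda>_::'a \<Rightarrow> real. euclideanreal) C"
  have W: "weak_star K M = pullback_topology (Prob M) \<Phi> P"
    by (simp add: weak_star_def \<Phi>_def C_def P_def Let_def)
  have top: "\<Phi> \<nu> \<in> topspace P" for \<nu> by (simp add: \<Phi>_def P_def)
  have P: "limitin P (\<lambda>n. \<Phi> (s n)) (\<Phi> \<mu>) F \<longleftrightarrow>
      (\<forall>f\<in>C. ((\<lambda>n. \<integral>z. f z \<partial>s n) \<longlongrightarrow> (\<integral>z. f z \<partial>\<mu>)) F)"
    unfolding P_def by (auto simp: limitin_componentwise \<Phi>_def)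
  have "limitin (weak_star K M) s \<mu> F \<longleftrightarrow>
      \<mu> \<in> Prob M \<and> (\<forall>\<^sub>F n in F. s n \<in> Prob M) \<and> limitin P (\<lambda>n. \<Phi> (s n)) (\<Phi> \<mu>) F"
  proof (intro iffI conjI)
    assume L: "limitin (weak_star K M) s \<mu> F"
    show m: "\<mu> \<in> Prob M" using L by (simp add: limitin_def topspace_weak_star)
    show "\<forall>\<^sub>F n in F. s n \<in> Prob M"
      using L m openin_topspace[of "weak_star K M"] unfolding limitin_def topspace_weak_star by blast
    show "limitin P (\<lambda>n. \<Phi> (s n)) (\<Phi> \<mu>) F"
      unfolding limitin_def
    proof (intro conjI allI impI top)
      fix U assume U: "openin P U \<and> \<Phi> \<mu> \<in> U"
      then have "openin (weak_star K M) (\<Phi> -` U \<inter> Prob M)"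
        unfolding W openin_pullback_topology by blast
      with L U m have "\<forall>\<^sub>F n in F. s n \<in> \<Phi> -` U \<inter> Prob M" unfolding limitin_def by blast
      then show "\<forall>\<^sub>F n in F. \<Phi> (s n) \<in> U" by (rule eventually_mono) simp
    qed
  next
    assume R: "\<mu> \<in> Prob M \<and> (\<forall>\<^sub>F n in F. s n \<in> Prob M) \<and> limitin P (\<lambda>n. \<Phi> (s n)) (\<Phi> \<mu>) F"
    show "limitin (weak_star K M) s \<mu> F"
      unfolding limitin_def topspace_weak_star
    proof (intro conjI allI impI)
      fix V assume V: "openin (weak_star K M) V \<and> \<mu> \<in> V"
      then obtain U where U: "openin P U" "V = \<Phi> -` U \<inter> Prob M"
        unfolding W openin_pullback_topology by blast
      then have "\<forall>\<^sub>F n in F. \<Phi> (s n) \<in> U" using R V unfolding limitin_def by blast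
      moreover have "\<forall>\<^sub>F n in F. s n \<in> Prob M" using R by blast
      ultimately show "\<forall>\<^sub>F n in F. s n \<in> V"
        by eventually_elim (simp add: U(2))
    qed (use R in blast)
  qed
  then show ?thesis unfolding P by (simp add: C_def)
qed

definition seq_cluster_point :: "'a topology \<Rightarrow> (nat \<Rightarrow> 'a) \<Rightarrow> 'a \<Rightarrow> bool" where
  "seq_cluster_point T s l \<longleftrightarrow>
     l \<in> topspace T \<and> (\<forall>U. openin T U \<longrightarrow> l \<in> U \<longrightarrow> (\<exists>\<^sub>F n in sequentially. s n \<in> U))"

definition empirical_holonomic ::
  "(circle \<times> nat \<times> nat) topology \<Rightarrow> nat \<Rightarrow> (circle \<times> nat \<times> nat) measure set" where
  "empirical_holonomic K m = {\<mu>. \<exists>x0 cbar abar.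
     (\<forall>i. cbar i \<in> {..<m}) \<and> (\<forall>i. abar i \<in> {0, 1}) \<and>
     seq_cluster_point (weak_star K (phase_space m)) (empirical m cbar abar x0) \<mu>}"

text \<open>Choice of the topology on \<open>X \<times> \<C> \<times> \<I>\<close>.  With representatives in \<open>[0,1)\<close> the map \<open>tau a\<close> is
  discontinuous at the point \<open>0\<close> of the circle; only the pair of the two preimages of \<open>x\<close> under the
  doubling map, as a set, varies continuously.  Hence \<open>(x, c, a) \<mapsto> g (tau a x)\<close> is not continuous
  for the product of the circle with the discrete sets, and with that product topology weak-*
  cluster points of empirical measures need not be holonomic (\<open>product_topology_not_holonomic\<close>).
  The weak-* topology is therefore taken for \<open>phase_topology\<close>, which makes the bijection
  \<open>(x, c, a) \<mapsto> (tau a x, c)\<close> onto \<open>X \<times> \<C>\<close> a homeomorphism: \<open>X \<times> \<I>\<close> is the double cover of the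
  circle.  Being Hausdorff, the target leaves no other compact topology for which this bijection
  is continuous.  The two topologies have the same neighbourhoods at every point with \<open>x \<noteq> 0\<close>.\<close>

lemma cesaro_mean_tendsto:
  fixes u :: "nat \<Rightarrow> real"
  assumes "u \<longlonglongrightarrow> l"
  shows "(\<lambda>n. (\<Sum>i<n. u i) / real n) \<longlonglongrightarrow> l"
proof (rule LIMSEQ_I)
  fix e :: real assume e: "0 < e"
  obtain N where N: "\<And>i. i \<ge> N \<Longrightarrow> \<bar>u i - l\<bar> < e / 2"
    using LIMSEQ_D[OF assms, of "e/2"] e by auto
  define S where "S = (\<Sum>i<N. \<bar>u i - l\<bar>)"
  obtain M :: nat where M: "2 * S / e < real M" using reals_Archimedean2 by blast
  show "\<exists>no. \<forall>n\<ge>no. norm ((\<Sum>i<n. u i) / real n - l) < e"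
  proof (intro exI allI impI)
    fix n assume n: "n \<ge> Suc (max N M)"
    then have n0: "0 < real n" by simp
    have "\<bar>(\<Sum>i<n. u i) - real n * l\<bar> = \<bar>\<Sum>i<n. (u i - l)\<bar>" by (simp add: sum_subtractf)
    also have "\<dots> \<le> (\<Sum>i<n. \<bar>u i - l\<bar>)" by (rule sum_abs)
    also have "\<dots> = S + (\<Sum>i\<in>{N..<n}. \<bar>u i - l\<bar>)"
      using n unfolding S_def by (subst sum.union_disjoint[symmetric]) (auto intro!: sum.cong)
    also have "(\<Sum>i\<in>{N..<n}. \<bar>u i - l\<bar>) \<le> real (card {N..<n}) * (e / 2)"
      using N by (intro sum_bounded_above) (auto intro: less_imp_le)
    also have "\<dots> \<le> real n * (e / 2)" using e by (intro mult_right_mono) auto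
    also have "S < real n * (e / 2)"
    proof -
      have "2 * S / e < real n" using M n by linarith
      then show ?thesis using e by (simp add: field_simps)
    qed
    finally have "\<bar>(\<Sum>i<n. u i) - real n * l\<bar> < real n * e" by (simp add: field_simps)
    moreover have "(\<Sum>i<n. u i) / real n - l = ((\<Sum>i<n. u i) - real n * l) / real n"
      using n0 by (simp add: field_simps)
    ultimately show "norm ((\<Sum>i<n. u i) / real n - l) < e"
      using n0 by (simp add: abs_divide pos_divide_less_eq mult.commute)
  qed
qed

lemma product_topology_not_holonomic:
  assumes "0 < m"
  shows "\<not> empirical_holonomic
    (prod_topology euclidean (prod_topology (discrete_topology {..<m}) (discrete_topology {0, 1}))) m
      \<subseteq> holonomic m"
proof -
  define K :: "(circle \<times> nat \<times> nat) topology" where "K = 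
    prod_topology euclidean (prod_topology (discrete_topology {..<m}) (discrete_topology {0, 1}))"
  define x0 where "x0 = circle_of 0"
  let ?p = "(x0, 0, 1) :: circle \<times> nat \<times> nat"
  let ?s = "empirical m (\<lambda>_. 0) (\<lambda>_. 1) x0"
  define \<mu> where "\<mu> = return (phase_space m) ?p"
  have p: "?p \<in> space (phase_space m)" using assms by (simp add: space_phase_space)
  have orb: "orbit x0 (\<lambda>_. 1) i = circle_of (1 - (1/2) ^ i)" for i
  proof (induction i)
    case (Suc i)
    have "(0::real) < (1/2)^i" "(1/2)^i \<le> (1::real)" by (simp_all add: power_le_one)
    then have "frac (1 - (1/2) ^ i :: real) = 1 - (1/2) ^ i" by (intro frac_eq_id) auto
    then have "rep01 (orbit x0 (\<lambda>_. 1) i) = 1 - (1/2) ^ i"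
      unfolding Suc.IH rep01_circle_of .
    then show ?case by (simp add: tau_def diff_divide_distrib add_divide_distrib)
  qed (simp add: x0_def)
  have orb_lim: "(\<lambda>i. orbit x0 (\<lambda>_. 1) i) \<longlonglongrightarrow> x0"
  proof (rule metric_tendsto_imp_tendsto)
    show "(\<lambda>i. (1/2) ^ i :: real) \<longlonglongrightarrow> 0" by (rule LIMSEQ_power_zero) simp
    have d: "dist (circle_of (1 - t)) (circle_of 0) \<le> \<bar>t\<bar>" for t
      using dist_int_le[of 1 "1 - t"] by transfer simp
    have "dist (orbit x0 (\<lambda>_. 1) i) x0 \<le> dist ((1/2) ^ i :: real) 0" for i
      using d[of "(1/2) ^ i"] by (subst orb) (simp add: x0_def)
    then show "\<forall>\<^sub>F i in sequentially. dist (orbit x0 (\<lambda>_. 1) i) x0 \<le> dist ((1/2) ^ i :: real) 0"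
      by (intro always_eventually allI)
  qed
  have "limitin (weak_star K (phase_space m)) ?s \<mu> sequentially"
    unfolding limitin_weak_star
  proof (intro conjI allI impI)
    show mu: "\<mu> \<in> Prob (phase_space m)"
      unfolding \<mu>_def Prob_def using p by (simp add: prob_space_return)
    show "\<forall>\<^sub>F n in sequentially. ?s n \<in> Prob (phase_space m)"
      using assms by (intro eventually_mono[OF eventually_gt_at_top[of 0]] empirical_in_Prob) auto
    fix f :: "circle \<times> nat \<times> nat \<Rightarrow> real" assume f: "continuous_map K euclideanreal f"
    have cont: "continuous_on UNIV (\<lambda>x. f (x, c, a))" if "c < m" "a \<in> {0, 1}" for c a
    proof -
      have "continuous_map euclidean K (\<lambda>x. (x, c, a))"
        unfolding K_def using that by (auto simp: continuous_map_pairwise o_def)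
      from continuous_map_compose[OF this f] show ?thesis by (simp add: o_def)
    qed
    have fm: "f \<in> borel_measurable (phase_space m)"
      using cont by (intro borel_measurable_phase_space borel_measurable_continuous_onI) auto
    have "(\<lambda>i. f (orbit x0 (\<lambda>_. 1) i, 0, 1)) \<longlonglongrightarrow> f ?p"
      using continuous_on_tendsto_compose[OF cont orb_lim] assms by simp
    then have "(\<lambda>n. (\<Sum>i<n. f (orbit x0 (\<lambda>_. 1) i, 0, 1)) / real n) \<longlonglongrightarrow> f ?p"
      by (rule cesaro_mean_tendsto)
    moreover have "\<forall>\<^sub>F n in sequentially.
        (\<Sum>i<n. f (orbit x0 (\<lambda>_. 1) i, 0, 1)) / real n = (\<integral>z. f z \<partial>?s n)"
      using assms fm by (intro eventually_mono[OF eventually_gt_at_top[of 0]])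
        (auto simp: integral_empirical)
    ultimately have "(\<lambda>n. \<integral>z. f z \<partial>?s n) \<longlonglongrightarrow> f ?p" by (rule Lim_transform_eventually)
    moreover have "(\<integral>z. f z \<partial>\<mu>) = f ?p"
      unfolding \<mu>_def using p fm by (simp add: integral_return)
    ultimately show "(\<lambda>n. \<integral>z. f z \<partial>?s n) \<longlonglongrightarrow> (\<integral>z. f z \<partial>\<mu>)" by simp
  qed
  then have "seq_cluster_point (weak_star K (phase_space m)) ?s \<mu>"
    unfolding seq_cluster_point_def limitin_def
    by (auto intro!: eventually_frequently)
  then have "\<mu> \<in> empirical_holonomic K m"
    unfolding empirical_holonomic_def using assms by (intro CollectI exI conjI) auto
  moreover have "\<mu> \<notin> holonomic m"
  proof
    assume "\<mu> \<in> holonomic m"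
    moreover define g where "g = (\<lambda>x. dist x x0)"
    moreover have g: "continuous_on UNIV g" unfolding g_def by (intro continuous_intros)
    ultimately have "(\<integral>(x, c, a). g (tau a x) - g x \<partial>\<mu>) = 0" by (auto simp: holonomic_def)
    moreover have "(\<integral>(x, c, a). g (tau a x) - g x \<partial>\<mu>) = g (tau 1 x0) - g x0"
    proof -
      have [measurable]: "g \<in> borel_measurable borel"
        by (rule borel_measurable_continuous_onI[OF g])
      have "(\<lambda>(x, c, a). g (tau a x) - g x) \<in> borel_measurable (phase_space m)"
        by (rule borel_measurable_phase_space) simp
      then show ?thesis unfolding \<mu>_def using p by (simp add: integral_return)
    qed
    moreover have "tau 1 x0 \<noteq> x0"
    proof -
      have "rep01 (tau 1 x0) = 1/2" by (simp add: tau_def x0_def rep01_circle_of frac_eq)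
      then show ?thesis by (auto simp: x0_def rep01_circle_of)
    qed
    ultimately show False by (simp add: g_def)
  qed
  ultimately show ?thesis unfolding K_def by blast
qed

definition phase_topology :: "nat \<Rightarrow> (circle \<times> nat \<times> nat) topology" where
  "phase_topology m = pullback_topology (UNIV \<times> {..<m} \<times> {0, 1}) (\<lambda>(x, c, a). (tau a x, c))
     (prod_topology euclidean (discrete_topology {..<m}))"

lemma bij_betw_phase:
  "bij_betw (\<lambda>(x, c, a). (tau a x, c)) (UNIV \<times> {..<m :: nat} \<times> {0, 1}) (UNIV \<times> {..<m})"
proof (rule bij_betwI')
  fix z z' assume z: "z \<in> (UNIV :: circle set) \<times> {..<m} \<times> {0::nat, 1}" "z' \<in> (UNIV :: circle set) \<times> {..<m} \<times> {0::nat, 1}"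
  obtain x c a x' c' a' where e: "z = (x, c, a)" "z' = (x', c', a')" by (metis prod_cases3)
  have "a = a' \<and> x = x'" if t: "tau a x = tau a' x'"
  proof -
    have "rep01 x + real a = rep01 x' + real a'"
      using arg_cong[OF t, of rep01] z e by (simp add: rep01_tau)
    then have "a = a'" "rep01 x = rep01 x'"
      using z e rep01_bounds[of x] rep01_bounds[of x'] by auto
    then show ?thesis by (metis circle_of_rep01)
  qed
  then show "((case z of (x, c, a) \<Rightarrow> (tau a x, c)) = (case z' of (x, c, a) \<Rightarrow> (tau a x, c))) = (z = z')"
    by (auto simp: e)
  show "(case z of (x, c, a) \<Rightarrow> (tau a x, c)) \<in> UNIV \<times> {..<m}" using z by (auto simp: e)
next
  fix w :: "circle \<times> nat" assume w: "w \<in> UNIV \<times> {..<m}"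
  obtain y c where yc: "w = (y, c)" by fastforce
  define a :: nat where "a = (if rep01 y < 1/2 then 0 else 1)"
  define x where "x = circle_of (2 * rep01 y - real a)"
  have a: "a \<in> {0, 1}" by (simp add: a_def)
  have "rep01 x = 2 * rep01 y - real a"
    unfolding x_def rep01_circle_of using rep01_bounds[of y]
    by (intro frac_eq_id) (auto simp: a_def)
  then have "rep01 x / 2 + real a / 2 = rep01 y" by (simp add: field_simps)
  then have "tau a x = y" by (simp add: tau_def circle_of_rep01)
  then have "w = (case (x, c, a) of (x, c, a) \<Rightarrow> (tau a x, c))" by (simp add: yc)
  moreover have "(x, c, a) \<in> UNIV \<times> {..<m} \<times> {0, 1}" using w a yc by auto
  ultimately show "\<exists>z\<in>UNIV \<times> {..<m} \<times> {0, 1}. w = (case z of (x, c, a) \<Rightarrow> (tau a x, c))" by blast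
qed

lemma homeomorphic_map_phase_topology:
  "homeomorphic_map (phase_topology m) (prod_topology euclidean (discrete_topology {..<m}))
     (\<lambda>(x, c, a). (tau a x, c))"
proof -
  let ?P = "prod_topology euclidean (discrete_topology {..<m}) :: (circle \<times> nat) topology"
  let ?h = "\<lambda>(x, c, a). (tau a x, c)"
  let ?S = "UNIV \<times> {..<m} \<times> {0, 1}"
  have top: "topspace (phase_topology m) = ?S"
    by (auto simp: phase_topology_def topspace_pullback_topology)
  have im: "?h ` ?S = topspace ?P" using bij_betw_imp_surj_on[OF bij_betw_phase[of m]] by simp
  have "continuous_map (phase_topology m) ?P ?h"
    unfolding phase_topology_def using continuous_map_pullback[OF continuous_map_id[of ?P]] by simp
  moreover have "open_map (phase_topology m) ?P ?h"
    unfolding open_map_def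
  proof (intro allI impI)
    fix U assume "openin (phase_topology m) U"
    then obtain V where V: "openin ?P V" "U = ?h -` V \<inter> ?S"
      unfolding phase_topology_def openin_pullback_topology by blast
    have "?h ` U = V \<inter> ?h ` ?S" unfolding V(2) by blast
    then have "?h ` U = V" using im openin_subset[OF V(1)] by blast
    then show "openin ?P (?h ` U)" using V(1) by simp
  qed
  moreover have "inj_on ?h (topspace (phase_topology m))"
    unfolding top by (rule bij_betw_imp_inj_on[OF bij_betw_phase])
  ultimately show ?thesis
    using im top by (intro bijective_open_imp_homeomorphic_map) simp_all
qed

section \<open>Bellman equation and optimality\<close>

definition bellman_solution ::
  "nat \<Rightarrow> (nat \<Rightarrow> circle \<Rightarrow> real) \<Rightarrow> real \<Rightarrow> (circle \<Rightarrow> real) \<Rightarrow> bool" where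
  "bellman_solution m A lam v \<longleftrightarrow> (\<exists>L. L-lipschitz_on UNIV v) \<and>
     (\<forall>x. v x = (SUP (c, a)\<in>{..<m} \<times> {0, 1}. A c (tau a x) + lam * v (tau a x)))"

definition v_disc :: "nat \<Rightarrow> (nat \<Rightarrow> circle \<Rightarrow> real) \<Rightarrow> real \<Rightarrow> circle \<Rightarrow> real" where
  "v_disc m A lam = (THE v. bellman_solution m A lam v)"

text \<open>Maxima over the (compact, infinite) circle are written as suprema.\<close>

definition ubar :: "nat \<Rightarrow> (nat \<Rightarrow> circle \<Rightarrow> real) \<Rightarrow> real" where
  "ubar m A = Lim (at_left 1) (\<lambda>lam. (1 - lam) * (SUP x. v_disc m A lam x))"

definition sub_action :: "nat \<Rightarrow> (nat \<Rightarrow> circle \<Rightarrow> real) \<Rightarrow> (circle \<Rightarrow> real) \<Rightarrow> bool" where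
  "sub_action m A b \<longleftrightarrow>
     (\<forall>x. ubar m A = (MAX (c, a)\<in>{..<m} \<times> {0, 1}. A c (tau a x) + b (tau a x) - b x))"

definition optimal ::
  "nat \<Rightarrow> (nat \<Rightarrow> circle \<Rightarrow> real) \<Rightarrow> (circle \<Rightarrow> real) \<Rightarrow> (nat \<Rightarrow> nat) \<Rightarrow> (nat \<Rightarrow> nat) \<Rightarrow> circle \<Rightarrow> bool" where
  "optimal m A b cbar abar x0 \<longleftrightarrow> (\<forall>i. ubar m A =
     A (cbar i) (tau (abar i) (orbit x0 abar i)) + b (tau (abar i) (orbit x0 abar i)) - b (orbit x0 abar i))"

end

theory Submission
  imports Defs
begin

text \<open>
  Along an orbit the coboundary \<open>g (tau a x) - g x\<close> telescopes, so its mean over \<open>n\<close> steps is at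
  most \<open>2 max \<bar>g\<bar> / n\<close>.  It is also a continuous function on the phase space: there \<open>(x, c, a)\<close> is
  identified with \<open>(y, c)\<close>, \<open>y = tau a x\<close>, and \<open>x\<close> is recovered from \<open>y\<close> as \<open>2 y\<close>, which is
  continuous in \<open>y\<close>.  Hence the integral of the coboundary passes to every weak-* cluster point and
  vanishes there: empirical cluster points are holonomic.

  The sub-action equation says that the payoff \<open>A c (tau a x)\<close> is at most \<open>ubar\<close> minus the
  coboundary of \<open>b\<close>.  Integrating against any holonomic probability, not only an empirical one,
  removes the coboundary and leaves the upper bound \<open>ubar\<close> (\<open>holonomic_payoff_le_ubar\<close>), so neither
  of the two suprema exceeds \<open>ubar\<close>.  Along an optimal orbit the inequality is an equality at each step, so the
  mean payoffs converge to \<open>ubar\<close> and each cluster point has payoff exactly \<open>ubar\<close>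
  (\<open>optimal_empirical_payoff\<close>).

  It remains to see that the bound is attained by some empirical cluster point; then both suprema
  equal \<open>ubar\<close>.  Choosing at each point a maximiser in the
  sub-action equation produces optimal controls from any starting point, and the empirical measures
  along them have a cluster point because the probabilities on the phase space are weak-*
  sequentially compact (\<open>weak_star_sequentially_compact\<close>).  The compactness is reduced to Helly's
  selection theorem by cutting the circle open and laying the \<open>m\<close> copies of it side by side on the
  real line.
\<close>

section \<open>The doubling map and continuity on the phase space\<close>

lift_definition double :: "circle \<Rightarrow> circle" is "\<lambda>t. 2 * t"
proof -
  fix s t :: real
  assume "circle_rel s t"
  then have "2 * (s - t) \<in> \<int>"
    unfolding circle_rel_def by (intro Ints_mult) auto
  then show "circle_rel (2 * s) (2 * t)"
    by (simp add: circle_rel_def algebra_simps)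
qed

lemma double_circle_of: "double (circle_of t) = circle_of (2 * t)"
  by transfer (simp add: circle_rel_def)

lemma continuous_on_double: "continuous_on UNIV double"
proof -
  have le: "dist (double x) (double y) \<le> 2 * dist x y" for x y
  proof transfer
    fix x y :: real
    have "\<bar>(2 * x - 2 * y) - of_int (round (2 * x - 2 * y))\<bar>
        \<le> \<bar>(2 * x - 2 * y) - 2 * of_int (round (x - y))\<bar>"
      by (rule dist_int_le) (auto intro: Ints_mult)
    also have "\<dots> = 2 * \<bar>(x - y) - of_int (round (x - y))\<bar>"
      by (simp add: abs_if)
    finally show "\<bar>(2 * x - 2 * y) - of_int (round (2 * x - 2 * y))\<bar>
        \<le> 2 * \<bar>(x - y) - of_int (round (x - y))\<bar>" .
  qed
  have "2-lipschitz_on UNIV double"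
    by (rule lipschitz_onI) (use le in auto)
  then show ?thesis
    by (rule lipschitz_on_continuous_on)
qed

lemma circle_of_add_nat: "circle_of (t + real k) = circle_of t"
  by transfer (simp add: circle_rel_def)

lemma double_tau: "double (tau a x) = x"
  by (simp add: tau_def double_circle_of distrib_left circle_of_add_nat circle_of_rep01)

lemma compact_circle: "compact (UNIV :: circle set)"
proof -
  have "x \<in> circle_of ` {0..1}" for x
    using rep01_bounds[of x] by (intro image_eqI[of _ _ "rep01 x"]) (auto simp: circle_of_rep01)
  then have "(UNIV :: circle set) = circle_of ` {0..1}"
    by blast
  moreover have "compact (circle_of ` {0..1})"
    by (intro compact_continuous_image continuous_on_subset[OF continuous_on_circle_of]) auto
  ultimately show ?thesis
    by simp
qed

lemma continuous_circle_bounded: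
  fixes g :: "circle \<Rightarrow> real"
  assumes "continuous_on UNIV g"
  obtains B where "\<And>x. \<bar>g x\<bar> \<le> B"
proof -
  have "bounded (range g)"
    by (intro compact_imp_bounded compact_continuous_image assms compact_circle)
  then show ?thesis
    using that unfolding bounded_iff by auto
qed

text \<open>
  In the coordinates \<open>(y, c)\<close>, \<open>y = tau a x\<close>, the phase space is a disjoint union of \<open>m\<close> circles.
  A continuous function on it is therefore a family of \<open>m\<close> continuous functions of \<open>y\<close>; this lemma
  and the next give the two directions.
\<close>

lemma continuous_map_phase_topologyI:
  assumes "\<And>c. c < m \<Longrightarrow> continuous_on UNIV (F c)"
  shows "continuous_map (phase_topology m) euclideanreal (\<lambda>(x, c, a). F c (tau a x))"
proof -
  have "continuous_map (prod_topology euclidean (discrete_topology {..<m})) euclideanreal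
      (\<lambda>(y, c). F c y)"
    unfolding continuous_map_def
  proof (intro conjI allI impI)
    fix U :: "real set"
    assume "openin euclideanreal U"
    then have "open U" by simp
    let ?V = "{z \<in> topspace (prod_topology euclidean (discrete_topology {..<m})).
      (case z of (y, c) \<Rightarrow> F c y) \<in> U}"
    have "?V = (\<Union>c\<in>{..<m}. (F c -` U) \<times> {c})"
      by auto
    moreover have "openin (prod_topology euclidean (discrete_topology {..<m}))
        ((F c -` U) \<times> {c})" if "c < m" for c
      using open_vimage[OF \<open>open U\<close> assms[OF that]] that
      by (auto simp: openin_prod_Times_iff)
    ultimately show "openin (prod_topology euclidean (discrete_topology {..<m})) ?V"
      by auto
  qed auto
  from continuous_map_pullback[OF this,
      of "UNIV \<times> {..<m} \<times> {0, 1}" "\<lambda>(x, c, a). (tau a x, c)"]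
  show ?thesis
    by (simp add: phase_topology_def o_def case_prod_unfold)
qed

lemma continuous_map_phase_topologyE:
  assumes "continuous_map (phase_topology m) euclideanreal f"
  obtains F where "\<And>c. c < m \<Longrightarrow> continuous_on UNIV (F c)"
    "\<And>x c a. c < m \<Longrightarrow> a \<in> {0, 1} \<Longrightarrow> f (x, c, a) = F c (tau a x)"
proof -
  let ?P = "prod_topology euclidean (discrete_topology {..<m}) :: (circle \<times> nat) topology"
  obtain g where g: "homeomorphic_maps (phase_topology m) ?P (\<lambda>(x, c, a). (tau a x, c)) g"
    using homeomorphic_map_phase_topology[of m] unfolding homeomorphic_map_maps by blast
  have "continuous_map ?P euclideanreal (f \<circ> g)"
    using g assms unfolding homeomorphic_maps_def by (blast intro: continuous_map_compose)
  moreover have "continuous_map euclidean ?P (\<lambda>y. (y, c))" if "c < m" for c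
    using that by (auto simp: continuous_map_pairwise o_def)
  ultimately have "continuous_on UNIV (\<lambda>y. f (g (y, c)))" if "c < m" for c
    using continuous_map_compose[of euclidean ?P "\<lambda>y. (y, c)" euclideanreal "f \<circ> g"] that
    by (simp add: o_def)
  moreover have "f (x, c, a) = f (g (tau a x, c))" if "c < m" "a \<in> {0, 1}" for x c a
  proof -
    have "(x, c, a) \<in> topspace (phase_topology m)"
      using that by (auto simp: phase_topology_def topspace_pullback_topology)
    then show ?thesis
      using g unfolding homeomorphic_maps_def by fastforce
  qed
  ultimately show ?thesis
    by (rule that)
qed

text \<open>
  As \<open>x = double (tau a x)\<close>, the coboundary is \<open>g y - g (double y)\<close> in the coordinate \<open>y\<close>.
\<close>

lemma coboundary_continuous_map:
  assumes "continuous_on UNIV g"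
  shows "continuous_map (phase_topology m) euclideanreal (\<lambda>(x, c, a). g (tau a x) - g x)"
proof -
  have "continuous_on UNIV (\<lambda>y. g y - g (double y))"
    by (intro continuous_on_diff assms continuous_on_compose2[OF assms continuous_on_double]) auto
  from continuous_map_phase_topologyI[where F = "\<lambda>_ y. g y - g (double y)", OF this]
  show ?thesis
    by (simp add: double_tau)
qed

lemma continuous_map_phase_measurable:
  assumes "continuous_map (phase_topology m) euclideanreal f"
  shows "f \<in> borel_measurable (phase_space m)"
proof (rule borel_measurable_phase_space)
  fix c a :: nat
  assume ca: "c \<in> {..<m}" "a \<in> {0, 1}"
  obtain F where F: "\<And>c. c < m \<Longrightarrow> continuous_on UNIV (F c)"
    "\<And>x c a. c < m \<Longrightarrow> a \<in> {0, 1} \<Longrightarrow> f (x, c, a) = F c (tau a x)"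
    by (rule continuous_map_phase_topologyE[OF assms]) blast
  have [measurable]: "F c \<in> borel_measurable borel"
    using F(1) ca by (intro borel_measurable_continuous_onI) auto
  have "(\<lambda>x. F c (tau a x)) \<in> borel_measurable borel"
    by measurable
  then show "(\<lambda>x. f (x, c, a)) \<in> borel_measurable borel"
    using F(2) ca by simp
qed

lemma continuous_map_phase_integrable:
  assumes f: "continuous_map (phase_topology m) euclideanreal f"
    and \<mu>: "\<mu> \<in> Prob (phase_space m)"
  shows "integrable \<mu> f"
proof -
  interpret prob_space \<mu>
    using \<mu> by (simp add: Prob_def)
  have sets: "sets \<mu> = sets (phase_space m)"
    using \<mu> by (simp add: Prob_def)
  obtain F where F: "\<And>c. c < m \<Longrightarrow> continuous_on UNIV (F c)"
    "\<And>x c a. c < m \<Longrightarrow> a \<in> {0, 1} \<Longrightarrow> f (x, c, a) = F c (tau a x)"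
    by (rule continuous_map_phase_topologyE[OF f]) blast
  have "\<exists>B. \<forall>y. \<bar>F c y\<bar> \<le> B" if "c < m" for c
    using continuous_circle_bounded[OF F(1)[OF that]] by blast
  then obtain B where B: "\<And>c y. c < m \<Longrightarrow> \<bar>F c y\<bar> \<le> B c"
    by metis
  have "\<bar>F c y\<bar> \<le> (\<Sum>c<m. \<bar>B c\<bar>)" if "c < m" for c y
    using B[OF that, of y] member_le_sum[of c "{..<m}" "\<lambda>c. \<bar>B c\<bar>"] that by fastforce
  then have "norm (f z) \<le> (\<Sum>c<m. \<bar>B c\<bar>)" if "z \<in> space \<mu>" for z
    using that F(2) sets_eq_imp_space_eq[OF sets] by (auto simp: space_phase_space)
  then show ?thesis
    using continuous_map_phase_measurable[OF f]
    by (intro integrable_const_bound[of _ "\<Sum>c<m. \<bar>B c\<bar>"]) (auto simp: measurable_cong_sets[OF sets refl])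
qed

section \<open>Weak-* cluster points and sequential compactness\<close>

text \<open>
  Integration of a fixed continuous function is weak-* continuous, so the integral at a cluster
  point is a cluster point of the integrals, and a convergent real sequence has only its limit.
\<close>

lemma integral_cluster_point:
  assumes f: "continuous_map K euclideanreal f"
    and s: "seq_cluster_point (weak_star K M) s \<mu>"
    and lim: "(\<lambda>n. \<integral>z. f z \<partial>s n) \<longlonglongrightarrow> l"
  shows "(\<integral>z. f z \<partial>\<mu>) = l"
proof (rule ccontr)
  assume ne: "(\<integral>z. f z \<partial>\<mu>) \<noteq> l"
  obtain U V where UV: "open U" "open V" "(\<integral>z. f z \<partial>\<mu>) \<in> U" "l \<in> V" "U \<inter> V = {}"
    using hausdorff[OF ne] by blast
  have "continuous_map (weak_star K M) euclideanreal (\<lambda>\<nu>. \<integral>z. f z \<partial>\<nu>)"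
  proof -
    let ?C = "{f. continuous_map K euclideanreal f}"
    have "continuous_map (product_topology (\<lambda>_. euclideanreal) ?C) euclideanreal (\<lambda>\<phi>. \<phi> f)"
      using f by (intro continuous_map_product_projection) simp
    from continuous_map_pullback[OF this, of "Prob M" "\<lambda>\<nu>. \<lambda>f\<in>?C. \<integral>z. f z \<partial>\<nu>"] f show ?thesis
      by (simp add: weak_star_def o_def Let_def)
  qed
  then have "openin (weak_star K M) {\<nu> \<in> topspace (weak_star K M). (\<integral>z. f z \<partial>\<nu>) \<in> U}"
    using UV(1) by (simp add: openin_continuous_map_preimage)
  moreover have "\<mu> \<in> {\<nu> \<in> topspace (weak_star K M). (\<integral>z. f z \<partial>\<nu>) \<in> U}"
    using s UV(3) by (simp add: seq_cluster_point_def)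
  ultimately have "\<exists>\<^sub>F n in sequentially. s n \<in> {\<nu> \<in> topspace (weak_star K M). (\<integral>z. f z \<partial>\<nu>) \<in> U}"
    using s unfolding seq_cluster_point_def by blast
  then have "\<exists>\<^sub>F n in sequentially. (\<integral>z. f z \<partial>s n) \<in> U"
    by (rule frequently_elim1) simp
  moreover have "\<forall>\<^sub>F n in sequentially. (\<integral>z. f z \<partial>s n) \<in> V"
    using lim UV by (simp add: topological_tendstoD)
  ultimately have "\<exists>n. (\<integral>z. f z \<partial>s n) \<in> U \<and> (\<integral>z. f z \<partial>s n) \<in> V"
    by (intro frequently_ex frequently_eventually_frequently)
  then show False
    using UV(5) by blast
qed

lemma subsequence_limit_cluster_point:
  assumes "limitin T (\<lambda>k. s (r k)) l sequentially" "strict_mono (r :: nat \<Rightarrow> nat)"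
  shows "seq_cluster_point T s l"
  unfolding seq_cluster_point_def
proof (intro conjI allI impI)
  show "l \<in> topspace T"
    using assms by (simp add: limitin_def)
  fix U
  assume "openin T U" "l \<in> U"
  then have "\<forall>\<^sub>F k in sequentially. s (r k) \<in> U"
    using assms by (simp add: limitin_def)
  then have "\<exists>\<^sub>F k in sequentially. s (r k) \<in> U"
    by (rule eventually_frequently[OF sequentially_bot])
  then show "\<exists>\<^sub>F n in sequentially. s n \<in> U"
    using filterlim_subseq[OF assms(2)] 
    by (auto simp: frequently_def filterlim_iff)
qed

lemma infdist_intervals_zero_iff:
  fixes t :: real
  assumes "0 < m"
  shows "infdist t (\<Union>c<m. {2 * real c .. 2 * real c + 1}) = 0 \<longleftrightarrow>
    (\<exists>c<m. 2 * real c \<le> t \<and> t \<le> 2 * real c + 1)"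
proof -
  let ?K = "\<Union>c<m. {2 * real c .. 2 * real c + 1}"
  have "closed ?K"
    by (intro closed_UN) auto
  moreover have "?K \<noteq> {}"
    using assms by force
  ultimately have "infdist t ?K = 0 \<longleftrightarrow> t \<in> ?K"
    using in_closed_iff_infdist_zero by blast
  then show ?thesis
    by auto
qed

text \<open>
  The point \<open>(x, c, a)\<close> is encoded as the real number \<open>rep01 y + 2 * c\<close> with \<open>y = tau a x\<close>, so that
  the \<open>c\<close>-th circle becomes the interval \<open>[2c, 2c + 1)\<close>.  The image measures live on a bounded set,
  hence are tight, and Helly's theorem yields a weakly convergent subsequence on the line.

  Two points need care when the limit is carried back.  The codes \<open>2c\<close> and \<open>2c + 1\<close> stand for the
  same point of the circle, which causes no harm because \<open>circle_of\<close> decodes both and is continuous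
  on the line.  Secondly, the limit must not charge the gaps between the intervals: this follows by
  testing convergence against the truncated distance to the union of the closed intervals.  A continuous
  function on the phase space then corresponds to a bounded continuous function on the line that
  agrees with it on the intervals and is interpolated in the gaps, and its integrals converge.
\<close>

theorem weak_star_sequentially_compact:
  assumes m: "0 < m" and s: "\<And>n. s n \<in> Prob (phase_space m)"
  shows "\<exists>r \<mu>. strict_mono (r :: nat \<Rightarrow> nat) \<and>
    limitin (weak_star (phase_topology m) (phase_space m)) (\<lambda>k. s (r k)) \<mu> sequentially"
proof -
  define enc :: "circle \<times> nat \<times> nat \<Rightarrow> real"
    where "enc = (\<lambda>(x, c, a). rep01 (tau a x) + 2 * real c)"
  define digit :: "circle \<Rightarrow> nat" where "digit y = (if rep01 y < 1/2 then 0 else 1)" for y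
  \<comment> \<open>Clamped to a valid index, so that decoding maps the whole line, gaps included, into the phase space.\<close>
  define comp :: "real \<Rightarrow> nat" where "comp t = min (m - 1) (nat \<lfloor>t / 2\<rfloor>)" for t
  define dec :: "real \<Rightarrow> circle \<times> nat \<times> nat"
    where "dec t = (double (circle_of t), comp t, digit (circle_of t))" for t
  \<comment> \<open>Equal to \<open>1\<close> on \<open>[0, 1]\<close> and to \<open>0\<close> outside \<open>[-1/2, 3/2]\<close>: its shifts by \<open>2c\<close> do not overlap.\<close>
  define bump :: "real \<Rightarrow> real" where "bump t = max 0 (min 1 (2 - 2 * \<bar>t - 1/2\<bar>))" for t
  define gap :: "real \<Rightarrow> real"
    where "gap t = min 1 (infdist t (\<Union>c<m. {2 * real c .. 2 * real c + 1}))" for t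
  have gap0: "gap t = 0 \<longleftrightarrow> (\<exists>c<m. 2 * real c \<le> t \<and> t \<le> 2 * real c + 1)" for t
    using infdist_intervals_zero_iff[OF m, of t] by (auto simp: gap_def min_def)
  have gap_bound: "0 \<le> gap t" "norm (gap t) \<le> 1" for t
    by (auto simp: gap_def infdist_nonneg)
  have gap_cont: "continuous_on UNIV gap"
    unfolding gap_def by (intro continuous_intros)
  have [measurable]: "gap \<in> borel_measurable borel" "circle_of \<in> borel_measurable borel"
    "double \<in> borel_measurable borel"
    by (intro borel_measurable_continuous_onI gap_cont continuous_on_circle_of continuous_on_double)+
  have tau_digit: "tau (digit y) (double y) = y" for y
  proof -
    have "(y, 0) \<in> (\<lambda>(x, c, a). (tau a x, c)) ` (UNIV \<times> {..<m} \<times> {0, 1})"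
      unfolding bij_betw_imp_surj_on[OF bij_betw_phase] using m by simp
    then have "\<exists>a\<in>{0, 1}. \<exists>x. tau a x = y"
      by auto
    then obtain a x where z: "a \<in> {0, 1}" "tau a x = y"
      by blast
    then have "rep01 y = rep01 x / 2 + real a / 2"
      using rep01_tau by blast
    then have "digit y = a"
      using z(1) rep01_bounds[of x] by (auto simp: digit_def)
    then show ?thesis
      using z double_tau by metis
  qed
  have enc_m: "enc \<in> borel_measurable (phase_space m)"
    by (rule borel_measurable_phase_space) (simp add: enc_def)
  have enc_gap: "gap (enc z) = 0" if "z \<in> space (phase_space m)" for z
    using that rep01_bounds by (force simp: gap0 enc_def space_phase_space less_imp_le)
  have dec_m: "dec \<in> borel \<rightarrow>\<^sub>M phase_space m"
  proof -
    have "comp \<in> borel \<rightarrow>\<^sub>M count_space {..<m}"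
      unfolding comp_def
    proof (rule measurable_compose[where f = "\<lambda>t. \<lfloor>t / 2\<rfloor>" and g = "\<lambda>i. min (m - 1) (nat i)"])
      show "(\<lambda>t::real. \<lfloor>t / 2\<rfloor>) \<in> borel \<rightarrow>\<^sub>M count_space UNIV" by measurable
      show "(\<lambda>i. min (m - 1) (nat i)) \<in> count_space UNIV \<rightarrow>\<^sub>M count_space {..<m}"
        using m by auto
    qed
    moreover have "(\<lambda>t. digit (circle_of t)) \<in> borel \<rightarrow>\<^sub>M count_space {0, 1}"
      unfolding digit_def by measurable
    ultimately show ?thesis
      unfolding dec_def phase_space_def by measurable
  qed
  define \<nu> where "\<nu> n = distr (s n) borel enc" for n
  have prob_s: "prob_space (s n)" and sets_s: "sets (s n) = sets (phase_space m)" for n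
    using s[of n] by (auto simp: Prob_def)
  have enc_s: "enc \<in> borel_measurable (s n)" for n
    using enc_m measurable_cong_sets[OF sets_s refl] by blast
  have space_s: "space (s n) = space (phase_space m)" for n
    by (rule sets_eq_imp_space_eq[OF sets_s])
  have rd: "real_distribution (\<nu> n)" for n
    unfolding \<nu>_def using prob_s enc_s by (intro prob_space.real_distribution_distr) auto
  have "measure (\<nu> n) {-1<..2 * real m} = 1" for n
  proof -
    have "enc z \<in> {-1<..2 * real m}" if z_s: "z \<in> space (s n)" for z
    proof -
      obtain x c a where z: "z = (x, c, a)" "c < m"
        using z_s by (auto simp: space_s space_phase_space)
      then show ?thesis
        using rep01_bounds[of "tau a x"] by (auto simp: enc_def)
    qed
    then have "enc -` {-1<..2 * real m} \<inter> space (s n) = space (s n)"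
      by blast
    then show ?thesis
      using enc_s prob_s by (simp add: \<nu>_def measure_distr prob_space.prob_space)
  qed
  then have "-1 < 2 * real m \<and> (\<forall>n. measure (\<nu> n) {-1<..2 * real m} > 1 - \<epsilon>)" if "0 < \<epsilon>" for \<epsilon>
    using that by simp
  then have "tight \<nu>"
    unfolding tight_def using rd by blast
  from tight_imp_convergent_subsubsequence[OF this strict_mono_id]
  obtain r M where r: "strict_mono r" and M: "real_distribution M" and conv: "weak_conv_m (\<nu> \<circ> r) M"
    by auto
  interpret M: real_distribution M by (rule M)
  have lim: "(\<lambda>k. \<integral>t. \<phi> t \<partial>\<nu> (r k)) \<longlonglongrightarrow> (\<integral>t. \<phi> t \<partial>M)"
    if "continuous_on UNIV \<phi>" "\<And>t. norm (\<phi> t) \<le> B" for \<phi> :: "real \<Rightarrow> real" and B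
    using weak_conv_imp_integral_bdd_continuous_conv[of "\<nu> \<circ> r" M \<phi> B] rd M conv that
    by (auto simp: continuous_on_eq_continuous_at)
  have transfer: "(\<integral>t. \<phi> t \<partial>\<nu> n) = (\<integral>z. \<phi> (enc z) \<partial>s n)"
    if "\<phi> \<in> borel_measurable borel" for \<phi> :: "real \<Rightarrow> real" and n
    unfolding \<nu>_def using enc_s that by (rule integral_distr)
  have "(\<integral>t. gap t \<partial>\<nu> n) = 0" for n
  proof -
    have "(\<integral>z. gap (enc z) \<partial>s n) = (\<integral>z. 0 \<partial>s n)"
      by (rule Bochner_Integration.integral_cong) (simp_all add: space_s enc_gap)
    then show ?thesis
      using transfer[of gap n] by simp
  qed
  then have "(\<integral>t. gap t \<partial>M) = 0"
    using lim[OF gap_cont gap_bound(2)] LIMSEQ_unique tendsto_const by simp blast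
  moreover have "integrable M gap"
    by (rule M.integrable_const_bound[of _ 1]) (use gap_bound in auto)
  ultimately have AE_gap: "AE t in M. gap t = 0"
    using integral_nonneg_eq_0_iff_AE[of M gap] gap_bound by simp
  define \<mu> where "\<mu> = distr M (phase_space m) dec"
  have dec_M: "dec \<in> M \<rightarrow>\<^sub>M phase_space m"
    using dec_m by simp
  have "limitin (weak_star (phase_topology m) (phase_space m)) (\<lambda>k. s (r k)) \<mu> sequentially"
    unfolding limitin_weak_star
  proof (intro conjI allI impI)
    show "\<mu> \<in> Prob (phase_space m)"
      unfolding \<mu>_def Prob_def using M.prob_space_distr[OF dec_M] by simp
    show "\<forall>\<^sub>F k in sequentially. s (r k) \<in> Prob (phase_space m)"
      using s by simp
    fix f :: "circle \<times> nat \<times> nat \<Rightarrow> real"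
    assume f: "continuous_map (phase_topology m) euclideanreal f"
    obtain F where F: "\<And>c. c < m \<Longrightarrow> continuous_on UNIV (F c)"
      "\<And>x c a. c < m \<Longrightarrow> a \<in> {0, 1} \<Longrightarrow> f (x, c, a) = F c (tau a x)"
      by (rule continuous_map_phase_topologyE[OF f]) blast
    define G where "G t = (\<Sum>c<m. bump (t - 2 * real c) * F c (circle_of t))" for t
    have G_eq: "G t = F c (circle_of t)" if c: "c < m" "2 * real c \<le> t" "t \<le> 2 * real c + 1" for t c
    proof -
      have "bump (t - 2 * real c') = (if c' = c then 1 else 0)" for c'
      proof (cases "c' = c")
        case False
        then have "real c' \<ge> real c + 1 \<or> real c' \<le> real c - 1"
          by linarith
        then show ?thesis
          using c False by (auto simp: bump_def max_def min_def abs_if)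
      qed (use c in \<open>auto simp: bump_def max_def min_def abs_if\<close>)
      then show ?thesis
        using c(1) by (simp add: G_def if_distrib[of "\<lambda>u. u * _"] sum.delta cong: if_cong)
    qed
    have G_cont: "continuous_on UNIV G"
      unfolding G_def bump_def
      by (intro continuous_intros continuous_on_compose2[OF F(1) continuous_on_circle_of]) auto
    have [measurable]: "G \<in> borel_measurable borel"
      by (rule borel_measurable_continuous_onI[OF G_cont])
    have "\<exists>B. \<forall>y. \<bar>F c y\<bar> \<le> B" if "c < m" for c
      using continuous_circle_bounded[OF F(1)[OF that]] by blast
    then obtain B where B: "\<And>c y. c < m \<Longrightarrow> \<bar>F c y\<bar> \<le> B c"
      by metis
    have G_bound: "norm (G t) \<le> (\<Sum>c<m. B c)" for t
      unfolding G_def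
    proof (rule sum_norm_le)
      fix c assume "c \<in> {..<m}"
      then have "\<bar>F c (circle_of t)\<bar> \<le> B c" using B by simp
      moreover have "\<bar>bump (t - 2 * real c)\<bar> \<le> 1" by (simp add: bump_def)
      ultimately have "\<bar>bump (t - 2 * real c)\<bar> * \<bar>F c (circle_of t)\<bar> \<le> 1 * B c"
        by (intro mult_mono) auto
      then show "norm (bump (t - 2 * real c) * F c (circle_of t)) \<le> B c"
        by (simp add: abs_mult)
    qed
    have "f z = G (enc z)" if z: "z \<in> space (phase_space m)" for z
    proof -
      obtain x c a where e: "z = (x, c, a)" "c < m" "a \<in> {0, 1}"
        using z by (auto simp: space_phase_space)
      have "circle_of (enc z) = tau a x"
        using circle_of_add_nat[of "rep01 (tau a x)" "2 * c"] by (simp add: e enc_def circle_of_rep01)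
      then show ?thesis
        using G_eq[of c "enc z"] e F(2) rep01_bounds[of "tau a x"] by (simp add: enc_def)
    qed
    then have "(\<integral>z. f z \<partial>s n) = (\<integral>z. G (enc z) \<partial>s n)" for n
      by (intro Bochner_Integration.integral_cong) (simp_all add: space_s)
    then have "(\<integral>z. f z \<partial>s n) = (\<integral>t. G t \<partial>\<nu> n)" for n
      using transfer[of G n] by simp
    moreover have "(\<integral>z. f z \<partial>\<mu>) = (\<integral>t. G t \<partial>M)"
    proof -
      have fm: "f \<in> borel_measurable (phase_space m)"
        by (rule continuous_map_phase_measurable[OF f])
      have "(\<integral>z. f z \<partial>\<mu>) = (\<integral>t. f (dec t) \<partial>M)"
        unfolding \<mu>_def by (rule integral_distr[OF dec_M fm])
      also have "\<dots> = (\<integral>t. G t \<partial>M)"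
      proof (rule integral_cong_AE)
        show "(\<lambda>t. f (dec t)) \<in> borel_measurable M"
          by (rule measurable_compose[OF dec_M fm])
        show "AE t in M. f (dec t) = G t"
          using AE_gap
        proof eventually_elim
          case (elim t)
          then obtain c where c: "c < m" "2 * real c \<le> t" "t \<le> 2 * real c + 1"
            unfolding gap0 by blast
          then have "\<lfloor>t / 2\<rfloor> = int c"
            by (intro floor_unique) auto
          then have "comp t = c"
            using c by (simp add: comp_def)
          moreover have "digit (circle_of t) \<in> {0, 1}"
            by (simp add: digit_def)
          ultimately show ?case
            using G_eq[OF c] F(2)[OF c(1)] by (simp add: dec_def tau_digit)
        qed
      qed simp
      finally show ?thesis .
    qed
    ultimately show "(\<lambda>k. \<integral>z. f z \<partial>s (r k)) \<longlonglongrightarrow> (\<integral>z. f z \<partial>\<mu>)"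
      using lim[OF G_cont G_bound] by simp
  qed
  then show ?thesis
    using r by blast
qed

section \<open>Empirical measures are asymptotically holonomic\<close>

text \<open>
  The integral telescopes to \<open>(g x\<^sub>n - g x\<^sub>0) / n\<close>, and \<open>g\<close> is bounded on the compact circle.
\<close>

lemma empirical_coboundary:
  fixes g :: "circle \<Rightarrow> real"
  assumes "continuous_on UNIV g" "\<And>i. cbar i \<in> {..<m}" "\<And>i. abar i \<in> {0, 1}"
  shows "(\<lambda>n. \<integral>(x, c, a). g (tau a x) - g x \<partial>empirical m cbar abar x0 n) \<longlonglongrightarrow> 0"
proof -
  obtain B where B: "\<And>x. \<bar>g x\<bar> \<le> B"
    using continuous_circle_bounded[OF assms(1)] by blast
  have eq: "(\<integral>(x, c, a). g (tau a x) - g x \<partial>empirical m cbar abar x0 n) =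
      (g (orbit x0 abar n) - g x0) / real n" if "0 < n" for n
  proof -
    have "(\<Sum>i<n. g (orbit x0 abar (Suc i)) - g (orbit x0 abar i)) = g (orbit x0 abar n) - g x0"
      using sum_lessThan_telescope[of "\<lambda>i. g (orbit x0 abar i)" n] by simp
    then show ?thesis
      using integral_empirical[OF assms(2,3) that
          continuous_map_phase_measurable[OF coboundary_continuous_map[OF assms(1)]]]
      by simp
  qed
  show ?thesis
  proof (rule Lim_null_comparison)
    show "\<forall>\<^sub>F n in sequentially.
        norm (\<integral>(x, c, a). g (tau a x) - g x \<partial>empirical m cbar abar x0 n) \<le> 2 * B / real n"
      using eventually_gt_at_top[of 0]
    proof eventually_elim
      case (elim n)
      have "\<bar>g (orbit x0 abar n) - g x0\<bar> \<le> 2 * B"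
        using B[of "orbit x0 abar n"] B[of x0] by linarith
      then show ?case
        using eq[OF elim] elim by (simp add: abs_divide divide_right_mono)
    qed
    show "(\<lambda>n. 2 * B / real n) \<longlonglongrightarrow> 0"
      by (rule lim_const_over_n)
  qed
qed

lemma empirical_holonomic_subset_holonomic:
  "empirical_holonomic (phase_topology m) m \<subseteq> holonomic m"
proof
  fix \<mu>
  assume "\<mu> \<in> empirical_holonomic (phase_topology m) m"
  then obtain x0 cbar abar where c: "\<And>i. cbar i \<in> {..<m}" "\<And>i. abar i \<in> {0, 1}"
    and cl: "seq_cluster_point (weak_star (phase_topology m) (phase_space m))
      (empirical m cbar abar x0) \<mu>"
    unfolding empirical_holonomic_def by blast
  have "\<mu> \<in> Prob (phase_space m)"
    using cl by (simp add: seq_cluster_point_def topspace_weak_star)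
  moreover have "(\<integral>(x, c, a). g (tau a x) - g x \<partial>\<mu>) = 0" if "continuous_on UNIV g" for g :: "circle \<Rightarrow> real"
    by (rule integral_cluster_point[OF coboundary_continuous_map[OF that] cl
        empirical_coboundary[OF that c]])
  ultimately show "\<mu> \<in> holonomic m"
    by (simp add: holonomic_def)
qed

section \<open>Sub-actions and optimal controls\<close>

lemma sub_action_upper:
  assumes "sub_action m A b" "c < m" "a \<in> {0, 1}"
  shows "A c (tau a x) \<le> ubar m A - (b (tau a x) - b x)"
proof -
  have "A c (tau a x) + b (tau a x) - b x \<le>
      (MAX (c, a)\<in>{..<m} \<times> {0, 1}. A c (tau a x) + b (tau a x) - b x)"
    using assms by (intro Max_ge) (auto intro!: image_eqI[of _ _ "(c, a)"])
  also have "\<dots> = ubar m A"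
    using assms(1) by (simp add: sub_action_def)
  finally show ?thesis
    by simp
qed

lemma sub_action_attained:
  assumes "sub_action m A b" "0 < m"
  shows "\<exists>c\<in>{..<m}. \<exists>a\<in>{0, 1}. ubar m A = A c (tau a x) + b (tau a x) - b x"
proof -
  let ?S = "(\<lambda>(c, a). A c (tau a x) + b (tau a x) - b x) ` ({..<m} \<times> {0, 1})"
  have "Max ?S \<in> ?S"
    using assms(2) by (intro Max_in) auto
  moreover have "Max ?S = ubar m A"
    using assms(1) by (simp add: sub_action_def)
  ultimately show ?thesis
    by force
qed

text \<open>
  The controls are in feedback form: a maximiser is selected once for every point of the circle, and
  the orbit is generated by the selected branch.
\<close>

lemma optimal_controls_exist:
  assumes "sub_action m A b" "0 < m"
  obtains cbar abar where "\<And>i. cbar i \<in> {..<m}" "\<And>i. abar i \<in> {0, 1}"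
    "optimal m A b cbar abar x0"
proof -
  obtain \<gamma> \<alpha> where sel: "\<And>x. \<gamma> x \<in> {..<m}" "\<And>x. \<alpha> x \<in> {0, 1}"
    "\<And>x. ubar m A = A (\<gamma> x) (tau (\<alpha> x) x) + b (tau (\<alpha> x) x) - b x"
    using sub_action_attained[OF assms] by metis
  define y where "y i = ((\<lambda>x. tau (\<alpha> x) x) ^^ i) x0" for i
  have orb: "orbit x0 (\<lambda>i. \<alpha> (y i)) i = y i" for i
    by (induction i) (simp_all add: y_def)
  have "optimal m A b (\<lambda>i. \<gamma> (y i)) (\<lambda>i. \<alpha> (y i)) x0"
    unfolding optimal_def orb using sel(3) by blast
  then show ?thesis
    using sel(1,2) by (intro that[of "\<lambda>i. \<gamma> (y i)" "\<lambda>i. \<alpha> (y i)"])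
qed

text \<open>
  The payoff is dominated pointwise by \<open>ubar\<close> minus the coboundary of \<open>b\<close>, and the latter has
  integral zero by holonomy.
\<close>

lemma holonomic_payoff_le_ubar:
  assumes "\<And>c. c < m \<Longrightarrow> continuous_on UNIV (A c)" "continuous_on UNIV b" "sub_action m A b"
    and \<mu>: "\<mu> \<in> holonomic m"
  shows "(\<integral>(x, c, a). A c (tau a x) \<partial>\<mu>) \<le> ubar m A"
proof -
  have P: "\<mu> \<in> Prob (phase_space m)" and hol: "(\<integral>(x, c, a). b (tau a x) - b x \<partial>\<mu>) = 0"
    using \<mu> assms(2) by (auto simp: holonomic_def)
  interpret prob_space \<mu>
    using P by (simp add: Prob_def)
  have space: "space \<mu> = space (phase_space m)"
    using P sets_eq_imp_space_eq by (auto simp: Prob_def)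
  have ib: "integrable \<mu> (\<lambda>(x, c, a). b (tau a x) - b x)"
    by (rule continuous_map_phase_integrable[OF coboundary_continuous_map[OF assms(2)] P])
  have "(\<integral>(x, c, a). A c (tau a x) \<partial>\<mu>) \<le>
      (\<integral>z. ubar m A - (case z of (x, c, a) \<Rightarrow> b (tau a x) - b x) \<partial>\<mu>)"
  proof (rule integral_mono)
    show "integrable \<mu> (\<lambda>(x, c, a). A c (tau a x))"
      by (rule continuous_map_phase_integrable[OF continuous_map_phase_topologyI[OF assms(1)] P])
    show "integrable \<mu> (\<lambda>z. ubar m A - (case z of (x, c, a) \<Rightarrow> b (tau a x) - b x))"
      using ib by simp
    show "(case z of (x, c, a) \<Rightarrow> A c (tau a x)) \<le>
        ubar m A - (case z of (x, c, a) \<Rightarrow> b (tau a x) - b x)" if "z \<in> space \<mu>" for z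
      using that sub_action_upper[OF assms(3)] by (auto simp: space space_phase_space)
  qed
  also have "\<dots> = ubar m A"
    using ib hol by (simp add: prob_space)
  finally show ?thesis .
qed

text \<open>
  On an optimal orbit the payoff is equal to \<open>ubar\<close> minus the coboundary of \<open>b\<close>, whose means vanish
  asymptotically.
\<close>

lemma optimal_empirical_payoff:
  assumes "\<And>c. c < m \<Longrightarrow> continuous_on UNIV (A c)" "continuous_on UNIV b"
    and c: "\<And>i. cbar i \<in> {..<m}" "\<And>i. abar i \<in> {0, 1}"
    and opt: "optimal m A b cbar abar x0"
  shows "(\<lambda>n. \<integral>(x, c, a). A c (tau a x) \<partial>empirical m cbar abar x0 n) \<longlonglongrightarrow> ubar m A"
proof -
  let ?E = "empirical m cbar abar x0"
  have eq: "ubar m A - (\<integral>(x, c, a). b (tau a x) - b x \<partial>?E n) =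
      (\<integral>(x, c, a). A c (tau a x) \<partial>?E n)" if "0 < n" for n
  proof -
    let ?d = "\<lambda>i. b (orbit x0 abar (Suc i)) - b (orbit x0 abar i)"
    have "(\<integral>(x, c, a). A c (tau a x) \<partial>?E n) =
        (\<Sum>i<n. A (cbar i) (tau (abar i) (orbit x0 abar i))) / real n"
      using integral_empirical[OF c that
          continuous_map_phase_measurable[OF continuous_map_phase_topologyI[OF assms(1)]]]
      by simp
    also have "\<dots> = (\<Sum>i<n. ubar m A - ?d i) / real n"
    proof -
      have "A (cbar i) (tau (abar i) (orbit x0 abar i)) = ubar m A - ?d i" for i
        using opt[unfolded optimal_def, rule_format, of i] by simp
      then show ?thesis
        by (simp only:)
    qed
    also have "\<dots> = ubar m A - (\<Sum>i<n. ?d i) / real n"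
      using that by (simp add: sum_subtractf diff_divide_distrib)
    also have "(\<Sum>i<n. ?d i) / real n = (\<integral>(x, c, a). b (tau a x) - b x \<partial>?E n)"
      using integral_empirical[OF c that
          continuous_map_phase_measurable[OF coboundary_continuous_map[OF assms(2)]]]
      by simp
    finally show ?thesis ..
  qed
  have "(\<lambda>n. ubar m A - (\<integral>(x, c, a). b (tau a x) - b x \<partial>?E n)) \<longlonglongrightarrow> ubar m A - 0"
    by (intro tendsto_diff tendsto_const empirical_coboundary assms c)
  moreover have "\<forall>\<^sub>F n in sequentially. ubar m A - (\<integral>(x, c, a). b (tau a x) - b x \<partial>?E n) =
      (\<integral>(x, c, a). A c (tau a x) \<partial>?E n)"
    by (rule eventually_mono[OF eventually_gt_at_top[of 0]]) (rule eq)
  ultimately show ?thesis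
    using Lim_transform_eventually by fastforce
qed

lemma empirical_cluster_point_exists:
  assumes "0 < m" "\<And>i. cbar i \<in> {..<m}" "\<And>i. abar i \<in> {0, 1}"
  shows "\<exists>\<mu>. seq_cluster_point (weak_star (phase_topology m) (phase_space m))
    (empirical m cbar abar x0) \<mu>"
proof -
  \<comment> \<open>Shifted by one, since the mean over zero steps is not a probability.\<close>
  have "empirical m cbar abar x0 (Suc n) \<in> Prob (phase_space m)" for n
    using assms by (intro empirical_in_Prob) auto
  from weak_star_sequentially_compact[OF assms(1), of "\<lambda>n. empirical m cbar abar x0 (Suc n)", OF this]
  obtain r \<mu> where r: "strict_mono r" and lim:
    "limitin (weak_star (phase_topology m) (phase_space m))
      (\<lambda>k. empirical m cbar abar x0 (Suc (r k))) \<mu> sequentially"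
    by blast
  have "strict_mono (\<lambda>k. Suc (r k))"
    using r by (simp add: strict_mono_def)
  with lim show ?thesis
    using subsequence_limit_cluster_point[of _ "empirical m cbar abar x0" "\<lambda>k. Suc (r k)"] by blast
qed

theorem theorem3p1:
  fixes m :: nat
    and A :: "nat \<Rightarrow> circle \<Rightarrow> real"
    and b :: "circle \<Rightarrow> real"
    and lam :: "nat \<Rightarrow> real"
  assumes "2 \<le> m"
    and "\<And>c. c \<in> {..<m} \<Longrightarrow> \<exists>L. L-lipschitz_on UNIV (A c)"
    and "continuous_on UNIV b"
    and "\<And>k. 0 < lam k \<and> lam k < 1" and "lam \<longlonglongrightarrow> 1"
    and "\<And>x. (\<lambda>k. v_disc m A (lam k) x - (SUP y. v_disc m A (lam k) y)) \<longlonglongrightarrow> b x"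
    and "sub_action m A b"
  shows "empirical_holonomic (phase_topology m) m \<subseteq> holonomic m
    \<and> (\<forall>\<mu> \<in> empirical_holonomic (phase_topology m) m.
          (\<integral>(x, c, a). A c (tau a x) \<partial>\<mu>) \<le> ubar m A)
    \<and> (\<forall>x0 cbar abar \<mu> n.
          (\<forall>i. cbar i \<in> {..<m}) \<longrightarrow> (\<forall>i. abar i \<in> {0, 1}) \<longrightarrow>
          optimal m A b cbar abar x0 \<longrightarrow> strict_mono n \<longrightarrow>
          limitin (weak_star (phase_topology m) (phase_space m))
            (\<lambda>k. empirical m cbar abar x0 (n k)) \<mu> sequentially \<longrightarrow>
          (\<integral>(x, c, a). A c (tau a x) \<partial>\<mu>) = ubar m A)
    \<and> (SUP \<mu>\<in>empirical_holonomic (phase_topology m) m.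
          \<integral>(x, c, a). A c (tau a x) \<partial>\<mu>) = ubar m A
    \<and> ubar m A = m_value m A"
proof -
  let ?W = "weak_star (phase_topology m) (phase_space m)"
  let ?H0 = "empirical_holonomic (phase_topology m) m"
  let ?J = "\<lambda>\<mu>. \<integral>(x, c, a). A c (tau a x) \<partial>\<mu>"
  have m: "0 < m"
    using assms(1) by simp
  have A: "continuous_on UNIV (A c)" if "c < m" for c
    using assms(2)[of c] that lipschitz_on_continuous_on by auto
  have sub: "?H0 \<subseteq> holonomic m"
    by (rule empirical_holonomic_subset_holonomic)
  have le: "?J \<mu> \<le> ubar m A" if "\<mu> \<in> holonomic m" for \<mu>
    by (rule holonomic_payoff_le_ubar[OF A assms(3,7) that])
  have cluster: "?J \<mu> = ubar m A"
    if "\<And>i. cbar i \<in> {..<m}" "\<And>i. abar i \<in> {0, 1}" "optimal m A b cbar abar x0"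
      "seq_cluster_point ?W (empirical m cbar abar x0) \<mu>" for x0 cbar abar \<mu>
    by (rule integral_cluster_point[OF continuous_map_phase_topologyI[OF A] that(4)
        optimal_empirical_payoff[OF A assms(3) that(1,2,3)]])
  obtain cbar abar where c: "\<And>i. cbar i \<in> {..<m}" "\<And>i. abar i \<in> {0, 1}"
    and opt: "optimal m A b cbar abar (circle_of 0)"
    by (rule optimal_controls_exist[OF assms(7) m]) blast
  obtain \<mu>0 where \<mu>0: "seq_cluster_point ?W (empirical m cbar abar (circle_of 0)) \<mu>0"
    using empirical_cluster_point_exists[OF m, of cbar abar] c by blast
  have mem: "\<mu>0 \<in> ?H0"
    using \<mu>0 c unfolding empirical_holonomic_def by blast
  have max: "?J \<mu>0 = ubar m A"
    by (rule cluster[OF c opt \<mu>0])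
  \<comment> \<open>Empirical and holonomic suprema coincide because one cluster point attains the common bound.\<close>
  have sup: "(SUP \<mu>\<in>S. ?J \<mu>) = ubar m A" if "?H0 \<subseteq> S" "S \<subseteq> holonomic m" for S
    using that mem max le by (intro cSup_eq_maximum) (auto intro!: image_eqI[of _ _ \<mu>0])
  show ?thesis
  proof (intro conjI allI impI ballI)
    show "?H0 \<subseteq> holonomic m"
      by (rule sub)
    show "?J \<mu> \<le> ubar m A" if "\<mu> \<in> ?H0" for \<mu>
      using that sub le by blast
    show "?J \<mu> = ubar m A"
      if "\<forall>i. cbar i \<in> {..<m}" "\<forall>i. abar i \<in> {0, 1}" "optimal m A b cbar abar x0"
        "strict_mono n" "limitin ?W (\<lambda>k. empirical m cbar abar x0 (n k)) \<mu> sequentially"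
      for x0 cbar abar \<mu> and n :: "nat \<Rightarrow> nat"
      using that(1,2)
      by (intro cluster[OF _ _ that(3)] subsequence_limit_cluster_point[OF that(5,4)]) auto
    show "(SUP \<mu>\<in>?H0. ?J \<mu>) = ubar m A"
      by (rule sup[OF order_refl sub])
    show "ubar m A = m_value m A"
      unfolding m_value_def by (rule sup[OF sub order_refl, symmetric])
  qed
qed

end
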